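(* Let $X,Y,Z$ be Tychonoff spaces and let $f:X\to Y$ and $g:Y\to Z$ be continuous maps. If $f$ and $g$ are $\kappa$-pseudo open, then $g\circ f$ is $\kappa$-pseudo open. If $f$ and $g$ are weakly $\kappa$-pseudo open, then $g\circ f$ is weakly $\kappa$-pseudo open.
   Context: All topological spaces are assumed to be Tychonoff. A continuous surjective map $f:X\to Y$ is called $\kappa$-pseudo open if whenever $y\in Y$, $U$ is open in $X$ and $f^{-1}(y)\subseteq U$, then $y\in\operatorname{Int}\big(\overline{f(U)}\big)$. A surjective continuous map $f:X\to Y$ is called weakly $\kappa$-pseudo open if an open set $U\subseteq Y$ is closed in $Y$ if and only if $f^{-1}(U)$ is closed in $X$. *)

theory Defs
  imports "HOL-Analysis.Analysis"
begin

definition tychonoff_space :: "'a topology \<Rightarrow> bool" where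
  "tychonoff_space X \<longleftrightarrow> t1_space X \<and> completely_regular_space X"

definition kappa_pseudo_open_map :: "'a topology \<Rightarrow> 'b topology \<Rightarrow> ('a \<Rightarrow> 'b) \<Rightarrow> bool" where
  "kappa_pseudo_open_map X Y f \<longleftrightarrow>
     continuous_map X Y f \<and> f ` topspace X = topspace Y \<and>
     (\<forall>y \<in> topspace Y. \<forall>U. openin X U \<and> {x \<in> topspace X. f x = y} \<subseteq> U
        \<longrightarrow> y \<in> Y interior_of (Y closure_of (f ` U)))"

definition weakly_kappa_pseudo_open_map :: "'a topology \<Rightarrow> 'b topology \<Rightarrow> ('a \<Rightarrow> 'b) \<Rightarrow> bool" where
  "weakly_kappa_pseudo_open_map X Y f \<longleftrightarrow>
     continuous_map X Y f \<and> f ` topspace X = topspace Y \<and>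
     (\<forall>U. openin Y U \<longrightarrow> (closedin Y U \<longleftrightarrow> closedin X {x \<in> topspace X. f x \<in> U}))"

end

theory Submission
  imports Defs
begin

lemma kappa_pseudo_open_map_compose:
  assumes f: "kappa_pseudo_open_map X Y f" and g: "kappa_pseudo_open_map Y Z g"
  shows "kappa_pseudo_open_map X Z (g \<circ> f)"
  unfolding kappa_pseudo_open_map_def
proof (intro conjI ballI allI impI)
  have contf: "continuous_map X Y f" and surjf: "f ` topspace X = topspace Y"
    and contg: "continuous_map Y Z g" and surjg: "g ` topspace Y = topspace Z"
    using f g by (simp_all add: kappa_pseudo_open_map_def)
  show "continuous_map X Z (g \<circ> f)"
    using contf contg by (rule continuous_map_compose)
  show "(g \<circ> f) ` topspace X = topspace Z"
    by (simp only: image_comp [symmetric] surjf surjg)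
  fix z U
  assume z: "z \<in> topspace Z"
    and U: "openin X U \<and> {x \<in> topspace X. (g \<circ> f) x = z} \<subseteq> U"
  define V where "V = Y interior_of (Y closure_of (f ` U))"
  have "{y \<in> topspace Y. g y = z} \<subseteq> V"
  proof
    fix y
    assume y: "y \<in> {y \<in> topspace Y. g y = z}"
    then have "{x \<in> topspace X. f x = y} \<subseteq> U"
      using U by auto
    then show "y \<in> V"
      using f U y unfolding V_def kappa_pseudo_open_map_def by blast
  qed
  moreover have "openin Y V"
    by (simp add: V_def)
  ultimately have "z \<in> Z interior_of (Z closure_of (g ` V))"
    using g z unfolding kappa_pseudo_open_map_def by blast
  moreover have "Z closure_of (g ` V) \<subseteq> Z closure_of ((g \<circ> f) ` U)"
  proof (rule closure_of_minimal)
    have "g ` V \<subseteq> g ` (Y closure_of (f ` U))"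
      unfolding V_def by (intro image_mono interior_of_subset)
    also have "\<dots> \<subseteq> Z closure_of (g ` f ` U)"
      using contg by (rule continuous_map_image_closure_subset)
    finally show "g ` V \<subseteq> Z closure_of ((g \<circ> f) ` U)"
      by (simp only: image_comp)
  qed simp
  ultimately show "z \<in> Z interior_of (Z closure_of ((g \<circ> f) ` U))"
    using interior_of_mono by blast
qed

text \<open>The two equivalences chain: the one for \<open>f\<close> may be used at the preimage of
  \<open>U\<close> under \<open>g\<close> because continuity of \<open>g\<close> makes that preimage
  open.\<close>

lemma weakly_kappa_pseudo_open_map_compose:
  assumes f: "weakly_kappa_pseudo_open_map X Y f" and g: "weakly_kappa_pseudo_open_map Y Z g"
  shows "weakly_kappa_pseudo_open_map X Z (g \<circ> f)"
  unfolding weakly_kappa_pseudo_open_map_def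
proof (intro conjI allI impI)
  have contf: "continuous_map X Y f" and surjf: "f ` topspace X = topspace Y"
    and contg: "continuous_map Y Z g" and surjg: "g ` topspace Y = topspace Z"
    using f g by (simp_all add: weakly_kappa_pseudo_open_map_def)
  show "continuous_map X Z (g \<circ> f)"
    using contf contg by (rule continuous_map_compose)
  show "(g \<circ> f) ` topspace X = topspace Z"
    by (simp only: image_comp [symmetric] surjf surjg)
  fix U
  assume U: "openin Z U"
  define V where "V = {y \<in> topspace Y. g y \<in> U}"
  have "openin Y V"
    unfolding V_def using contg U by (rule openin_continuous_map_preimage)
  then have "closedin Y V \<longleftrightarrow> closedin X {x \<in> topspace X. f x \<in> V}"
    using f by (simp add: weakly_kappa_pseudo_open_map_def)
  moreover have "closedin Z U \<longleftrightarrow> closedin Y V"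
    using g U by (simp add: weakly_kappa_pseudo_open_map_def V_def)
  \<comment> \<open>Membership in \<open>V\<close> also demands \<open>f x \<in> topspace Y\<close>,
    which \<open>surjf\<close> supplies.\<close>
  moreover have "{x \<in> topspace X. f x \<in> V} = {x \<in> topspace X. (g \<circ> f) x \<in> U}"
    using surjf by (auto simp: V_def)
  ultimately show "closedin Z U \<longleftrightarrow> closedin X {x \<in> topspace X. (g \<circ> f) x \<in> U}"
    by simp
qed

theorem proposition4p4:
  fixes X :: "'a topology" and Y :: "'b topology" and Z :: "'c topology"
    and f :: "'a \<Rightarrow> 'b" and g :: "'b \<Rightarrow> 'c"
  assumes "tychonoff_space X" and "tychonoff_space Y" and "tychonoff_space Z"
    and "continuous_map X Y f" and "continuous_map Y Z g"
  shows "(kappa_pseudo_open_map X Y f \<and> kappa_pseudo_open_map Y Z g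
            \<longrightarrow> kappa_pseudo_open_map X Z (g \<circ> f)) \<and>
         (weakly_kappa_pseudo_open_map X Y f \<and> weakly_kappa_pseudo_open_map Y Z g
            \<longrightarrow> weakly_kappa_pseudo_open_map X Z (g \<circ> f))"
  using kappa_pseudo_open_map_compose weakly_kappa_pseudo_open_map_compose by blast

end
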